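(* Let $n$ be a positive integer and let $\mathscr{C}_{F_{k-1}}(n)$ be the set of compositions of $n$ in which each part equal to $k$ comes in $F_{k-1}$ colors (so parts equal to $1$ are not allowed). Then $\mathscr{C}_{F_{k-1}}(n)$ is in one-to-one correspondence with each of the following sets: (a) compositions of $n-1$ whose last part is odd; (b) compositions of $n$ whose last part is even. Moreover, for $n>2$, $\mathscr{C}_{F_{k-1}}(n)$ is in one-to-one correspondence with each of: (c) words of length $n-2$ over $\{0,1,2\}$ in which every maximal run of $1$s and every maximal run of $2$s has even length; (d) words of length $n-3$ over $\{0,1,2\}$ with no two adjacent nonzero letters. These sets are enumerated by the Jacobsthal numbers; namely $|\mathscr{C}_{F_{k-1}}(n)|=J_{n-1}$, where $J_0=0$, $J_1=1$, $J_m=J_{m-1}+2J_{m-2}$ for $m\ge2$.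
   Context: $F_0=0$, $F_1=1$, $F_n=F_{n-1}+F_{n-2}$ for $n\ge2$ are the Fibonacci numbers. A composition of $n$ is an ordered tuple of positive integers (parts) summing to $n$. Given a sequence $(w_k)_{k\ge1}$ of nonnegative integers, a $w$-colored composition of $n$ is a composition $(j_1,\dots,j_m)$ of $n$ together with a choice, for each $i$, of one of $w_{j_i}$ colors for the part $j_i$; $\mathscr{C}_{w_k}(n)$ denotes the set of such colored compositions. Here $w_k=F_{k-1}$. *)

theory Defs
  imports Main "HOL-Number_Theory.Fib"
begin

definition compositions :: "nat \<Rightarrow> nat list set" where
  "compositions n = {js. (\<forall>j\<in>set js. 0 < j) \<and> sum_list js = n}"

text \<open>A colored part is a pair of a part \<open>j\<close> and a color; the \<open>w j\<close> available colors
  are \<open>0, \<dots>, w j - 1\<close>. The value \<open>w 0\<close> is irrelevant, as parts are positive.\<close>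

definition colored_compositions :: "(nat \<Rightarrow> nat) \<Rightarrow> nat \<Rightarrow> (nat \<times> nat) list set" where
  "colored_compositions w n =
     {ps. map fst ps \<in> compositions n \<and> (\<forall>(j, c)\<in>set ps. c < w j)}"

text \<open>The composition of 0 is empty and has no last part.\<close>

definition compositions_last_odd :: "nat \<Rightarrow> nat list set" where
  "compositions_last_odd n = {js \<in> compositions n. js \<noteq> [] \<and> odd (last js)}"

definition compositions_last_even :: "nat \<Rightarrow> nat list set" where
  "compositions_last_even n = {js \<in> compositions n. js \<noteq> [] \<and> even (last js)}"

definition words :: "nat set \<Rightarrow> nat \<Rightarrow> nat list set" where
  "words A m = {xs. set xs \<subseteq> A \<and> length xs = m}"

text \<open>The positions \<open>i, \<dots>, j - 1\<close> of \<open>xs\<close> form a nonempty block of letters \<open>a\<close>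
  that cannot be extended to the left or to the right.\<close>

definition maximal_run :: "'a \<Rightarrow> 'a list \<Rightarrow> nat \<Rightarrow> nat \<Rightarrow> bool" where
  "maximal_run a xs i j \<longleftrightarrow>
     i < j \<and> j \<le> length xs \<and> (\<forall>k\<in>{i..<j}. xs ! k = a) \<and>
     (0 < i \<longrightarrow> xs ! (i - 1) \<noteq> a) \<and> (j < length xs \<longrightarrow> xs ! j \<noteq> a)"

definition even_run_words :: "nat \<Rightarrow> nat list set" where
  "even_run_words m =
     {xs \<in> words {0, 1, 2} m. \<forall>a\<in>{1, 2}. \<forall>i j. maximal_run a xs i j \<longrightarrow> even (j - i)}"

definition no_adjacent_nonzero_words :: "nat \<Rightarrow> nat list set" where
  "no_adjacent_nonzero_words m =
     {xs \<in> words {0, 1, 2} m.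
        \<forall>i. Suc i < length xs \<longrightarrow> \<not> (xs ! i \<noteq> 0 \<and> xs ! Suc i \<noteq> 0)}"

fun jacobsthal :: "nat \<Rightarrow> nat" where
  "jacobsthal 0 = 0"
| "jacobsthal (Suc 0) = 1"
| "jacobsthal (Suc (Suc m)) = jacobsthal (Suc m) + 2 * jacobsthal m"

end

(* Each of the five families has a cardinality satisfying the Jacobsthal recurrence. For colored
   compositions, splitting off the first part gives c(n+1) = F_0 c(n) + ... + F_n c(0), and the
   Fibonacci recurrence in the coefficients collapses this convolution. For compositions,
   incrementing the last part maps "last part odd" of n onto "last part even" of n+1, and
   what remains of "last part odd" ends in 1. For words, one strips the leading 0 or, for an initial
   letter a in {1, 2}, the leading block aa (even runs) or a0 (no adjacent nonzero letters). *)

theory Submission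
  imports Defs
begin

text \<open>The offset \<open>k\<close> serves families whose counts start further along the
  sequence: it is 0 for compositions, 1 for even-run words and 2 for words without adjacent nonzero
  letters.\<close>

lemma jacobsthal_recurrence_unique:
  assumes "f 0 = jacobsthal k" "f (Suc 0) = jacobsthal (Suc k)"
    and "\<And>m. f (Suc (Suc m)) = f (Suc m) + 2 * f m"
  shows "f m = jacobsthal (m + k)"
  using assms by (induction m rule: jacobsthal.induct) auto

section \<open>Colored compositions and the Fibonacci convolution\<close>

lemma finite_compositions: "finite (compositions n)"
proof -
  have "length js \<le> sum_list js" if "\<forall>j\<in>set js. 0 < j" for js :: "nat list"
    using that by (induction js) auto
  then have "compositions n \<subseteq> {js. set js \<subseteq> {..n} \<and> length js \<le> n}"
    by (auto simp: compositions_def intro: member_le_sum_list)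
  then show ?thesis
    by (rule finite_subset) (simp add: finite_lists_length_le)
qed

lemma compositions_0: "compositions 0 = {[]}"
proof -
  have "js \<in> compositions 0 \<longleftrightarrow> js = []" for js
    by (cases js) (auto simp: compositions_def)
  then show ?thesis
    by blast
qed

lemma colored_compositions_0: "colored_compositions w 0 = {[]}"
  by (auto simp: colored_compositions_def compositions_0)

text \<open>The first part is positive, hence some \<open>Suc k\<close>, and leaves
  \<open>n - k\<close> for the rest. The triple can be read off from the list, so the map is
  injective and cardinalities turn into a convolution.\<close>

lemma colored_compositions_Suc:
  "colored_compositions w (Suc n) =
     (\<lambda>(k, c, ps). (Suc k, c) # ps) ` (SIGMA k:{..n}. {..<w (Suc k)} \<times> colored_compositions w (n - k))"
  (is "_ = ?f ` ?S")
proof (intro subset_antisym subsetI)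
  fix qs
  assume qs: "qs \<in> colored_compositions w (Suc n)"
  then obtain j c ps where [simp]: "qs = (j, c) # ps"
    by (cases qs) (auto simp: colored_compositions_def compositions_def)
  from qs have "0 < j"
    by (simp add: colored_compositions_def compositions_def)
  then obtain k where [simp]: "j = Suc k"
    using gr0_implies_Suc by blast
  have "(k, c, ps) \<in> ?S"
    using qs by (auto simp: colored_compositions_def compositions_def)
  then show "qs \<in> ?f ` ?S"
    by (rule rev_image_eqI) simp
qed (auto simp: colored_compositions_def compositions_def)

lemma finite_colored_compositions: "finite (colored_compositions w n)"
proof (induction n rule: less_induct)
  case (less n)
  then show ?case
    by (cases n) (auto simp: colored_compositions_0 colored_compositions_Suc)
qed

lemma card_colored_compositions_Suc:
  "card (colored_compositions w (Suc n)) = (\<Sum>k\<le>n. w (Suc k) * card (colored_compositions w (n - k)))"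
  by (simp add: colored_compositions_Suc card_image inj_on_def card_cartesian_product
      finite_colored_compositions)

lemma card_fib_colored_compositions:
  "card (colored_compositions (\<lambda>k. fib (k - 1)) (Suc n)) = jacobsthal n"
proof -
  define c where "c n = card (colored_compositions (\<lambda>k. fib (k - 1)) n)" for n
  have c_Suc: "c (Suc n) = (\<Sum>k\<le>n. fib k * c (n - k))" for n
    by (simp add: c_def card_colored_compositions_Suc)
  \<comment> \<open>The term for \<open>k = 0\<close> vanishes because
    \<open>fib 0 = 0\<close>.\<close>
  have shift: "c (Suc (Suc n)) = (\<Sum>k\<le>n. fib (Suc k) * c (n - k))" for n
    unfolding c_Suc[of "Suc n"] by (subst sum.atMost_Suc_shift) simp
  \<comment> \<open>This time the term split off is \<open>fib 1 * c (Suc n)\<close>. The Fibonacci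
    rule then breaks the remaining sum into those of \<open>shift\<close> and
    \<open>c_Suc\<close>.\<close>
  have "c (Suc (Suc (Suc n))) = c (Suc n) + (\<Sum>k\<le>n. fib (Suc (Suc k)) * c (n - k))" for n
    unfolding shift[of "Suc n"] by (subst sum.atMost_Suc_shift) simp
  then have "c (Suc (Suc (Suc n))) = c (Suc (Suc n)) + 2 * c (Suc n)" for n
    by (simp add: shift[of n] c_Suc[of n] algebra_simps sum.distrib)
  \<comment> \<open>The recurrence holds only from \<open>c 1\<close> on, since
    \<open>c 0 = 1\<close>, \<open>c 1 = 0\<close> and \<open>c 2 = 1\<close>; so it is applied to
    the shifted sequence, which starts 0, 1.\<close>
  then have "c (Suc n) = jacobsthal (n + 0)"
    by (intro jacobsthal_recurrence_unique) (simp_all add: c_Suc, simp add: c_def colored_compositions_0)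
  then show ?thesis
    by (simp add: c_def)
qed

section \<open>Compositions by the parity of the last part\<close>

definition inc_last :: "nat list \<Rightarrow> nat list" where
  "inc_last js = butlast js @ [Suc (last js)]"

lemma inc_last_snoc: "inc_last (js @ [j]) = js @ [Suc j]"
  by (simp add: inc_last_def)

text \<open>The empty list has to be excluded: \<open>inc_last []\<close> coincides with
  \<open>inc_last [last []]\<close>, where \<open>last []\<close> is unspecified.\<close>

lemma inj_on_inc_last: "[] \<notin> A \<Longrightarrow> inj_on inc_last A"
  by (rule inj_onI) (metis append_butlast_last_id butlast_snoc inc_last_def last_snoc nat.inject)

lemma compositions_last_even_Suc:
  "compositions_last_even (Suc n) = inc_last ` compositions_last_odd n"
proof (intro subset_antisym subsetI)
  fix js
  assume js: "js \<in> compositions_last_even (Suc n)"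
  then obtain ks i where "js = ks @ [i]"
    by (cases js rule: rev_cases) (auto simp: compositions_last_even_def)
  with js obtain k where [simp]: "js = ks @ [Suc k]"
    by (cases i) (auto simp: compositions_last_even_def compositions_def)
  \<comment> \<open>As \<open>Suc k\<close> is even, \<open>k\<close> is odd and therefore still a
    positive part.\<close>
  have "ks @ [k] \<in> compositions_last_odd n"
    using js by (auto simp: compositions_last_even_def compositions_last_odd_def compositions_def odd_pos)
  then show "js \<in> inc_last ` compositions_last_odd n"
    by (rule rev_image_eqI) (simp add: inc_last_snoc)
next
  fix js
  assume "js \<in> inc_last ` compositions_last_odd n"
  then obtain js' where "js' \<in> compositions_last_odd n" "js = inc_last js'"
    by blast
  then show "js \<in> compositions_last_even (Suc n)"
    by (cases js' rule: rev_cases)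
      (auto simp: compositions_last_even_def compositions_last_odd_def compositions_def inc_last_snoc)
qed

lemma compositions_last_odd_Suc:
  "compositions_last_odd (Suc n) =
     (\<lambda>js. js @ [1]) ` compositions n \<union> inc_last ` compositions_last_even n"
proof (intro subset_antisym subsetI)
  fix js
  assume js: "js \<in> compositions_last_odd (Suc n)"
  then obtain ks i where "js = ks @ [i]"
    by (cases js rule: rev_cases) (auto simp: compositions_last_odd_def)
  with js obtain k where [simp]: "js = ks @ [Suc k]"
    by (cases i) (auto simp: compositions_last_odd_def compositions_def)
  show "js \<in> (\<lambda>js. js @ [1]) ` compositions n \<union> inc_last ` compositions_last_even n"
  proof (cases "k = 0")
    case True
    with js have "ks \<in> compositions n"
      by (auto simp: compositions_last_odd_def compositions_def)
    with True show ?thesis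
      by simp
  next
    case False
    with js have "ks @ [k] \<in> compositions_last_even n"
      by (auto simp: compositions_last_odd_def compositions_last_even_def compositions_def)
    then have "js \<in> inc_last ` compositions_last_even n"
      by (rule rev_image_eqI) (simp add: inc_last_snoc)
    then show ?thesis
      by simp
  qed
next
  fix js
  assume "js \<in> (\<lambda>js. js @ [1]) ` compositions n \<union> inc_last ` compositions_last_even n"
  then consider ks where "ks \<in> compositions n" "js = ks @ [1]"
    | js' where "js' \<in> compositions_last_even n" "js = inc_last js'"
    by blast
  then show "js \<in> compositions_last_odd (Suc n)"
  proof cases
    case 1
    then show ?thesis
      by (auto simp: compositions_last_odd_def compositions_def)
  next
    case 2
    then show ?thesis
      by (cases js' rule: rev_cases)
        (auto simp: compositions_last_even_def compositions_last_odd_def compositions_def inc_last_snoc)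
  qed
qed

lemma finite_compositions_last_odd: "finite (compositions_last_odd n)"
  and finite_compositions_last_even: "finite (compositions_last_even n)"
  by (simp_all add: compositions_last_odd_def compositions_last_even_def finite_compositions)

lemma compositions_last_odd_0: "compositions_last_odd 0 = {}"
  and compositions_last_even_0: "compositions_last_even 0 = {}"
  by (auto simp: compositions_last_odd_def compositions_last_even_def compositions_0)

text \<open>The total must be positive: the empty composition of 0 lies in neither parity
  class.\<close>

lemma card_compositions_Suc:
  "card (compositions (Suc n)) =
     card (compositions_last_odd (Suc n)) + card (compositions_last_even (Suc n))"
proof -
  have "compositions (Suc n) = compositions_last_odd (Suc n) \<union> compositions_last_even (Suc n)"
    by (auto simp: compositions_last_odd_def compositions_last_even_def compositions_def)
  moreover have "compositions_last_odd (Suc n) \<inter> compositions_last_even (Suc n) = {}"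
    by (auto simp: compositions_last_odd_def compositions_last_even_def)
  ultimately show ?thesis
    by (simp add: card_Un_disjoint finite_compositions_last_odd finite_compositions_last_even)
qed

lemma card_compositions_last_even_Suc:
  "card (compositions_last_even (Suc n)) = card (compositions_last_odd n)"
  unfolding compositions_last_even_Suc
  by (rule card_image, rule inj_on_inc_last) (simp add: compositions_last_odd_def)

lemma card_compositions_last_odd_Suc:
  "card (compositions_last_odd (Suc n)) = card (compositions n) + card (compositions_last_even n)"
proof -
  \<comment> \<open>A common element would come from a composition with last part 0.\<close>
  have "(\<lambda>js. js @ [1]) ` compositions n \<inter> inc_last ` compositions_last_even n = {}"
    by (auto simp: inc_last_def compositions_last_even_def compositions_def)
      (metis last_in_set less_irrefl)
  moreover have "card ((\<lambda>js. js @ [1]) ` compositions n) = card (compositions n)"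
    by (simp add: card_image inj_on_def)
  moreover have "card (inc_last ` compositions_last_even n) = card (compositions_last_even n)"
    by (rule card_image, rule inj_on_inc_last) (simp add: compositions_last_even_def)
  ultimately show ?thesis
    unfolding compositions_last_odd_Suc
    by (simp add: card_Un_disjoint finite_compositions finite_compositions_last_even)
qed

lemma card_compositions_last_odd: "card (compositions_last_odd n) = jacobsthal n"
proof -
  have "card (compositions_last_odd n) = jacobsthal (n + 0)"
  proof (rule jacobsthal_recurrence_unique)
    \<comment> \<open>With o, e, c counting odd last part, even last part and all compositions:
      o(m+2) = c(m+1) + e(m+1) = o(m+1) + 2 e(m+1), and e(m+1) = o(m).\<close>
    show "card (compositions_last_odd (Suc (Suc m))) =
      card (compositions_last_odd (Suc m)) + 2 * card (compositions_last_odd m)" for m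
      by (simp add: card_compositions_last_odd_Suc[of "Suc m"] card_compositions_Suc
          card_compositions_last_even_Suc)
  qed (simp_all add: card_compositions_last_odd_Suc compositions_last_odd_0
      compositions_last_even_0 compositions_0)
  then show ?thesis
    by simp
qed

section \<open>Words split by their first letter\<close>

lemma words_0: "words A 0 = {[]}"
  by (auto simp: words_def)

lemma finite_words: "finite A \<Longrightarrow> finite (words A m)"
  by (simp add: words_def finite_lists_length_eq)

lemma words_two_cases:
  assumes "xs \<in> words A (Suc (Suc m))"
  obtains x y zs where "xs = x # y # zs" "x \<in> A" "y \<in> A" "zs \<in> words A m" "y # zs \<in> words A (Suc m)"
  using assms by (auto simp: words_def length_Suc_conv)

text \<open>Distinct first letters make the three images disjoint. Here \<open>g a\<close> is the
  letter forced after an initial nonzero \<open>a\<close>: \<open>a\<close> itself for even runs, 0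
  for words without adjacent nonzero letters.\<close>

lemma jacobsthal_step_card:
  fixes P Q :: "nat list set"
  assumes "S = Cons 0 ` P \<union> (\<lambda>xs. 1 # g 1 # xs) ` Q \<union> (\<lambda>xs. 2 # g 2 # xs) ` Q" "finite P" "finite Q"
  shows "card S = card P + 2 * card Q"
proof -
  have "card S = card (Cons 0 ` P \<union> (\<lambda>xs. 1 # g 1 # xs) ` Q) + card ((\<lambda>xs. 2 # g 2 # xs) ` Q)"
    unfolding assms(1) using assms(2,3) by (intro card_Un_disjoint) auto
  also have "card (Cons 0 ` P \<union> (\<lambda>xs. 1 # g 1 # xs) ` Q) =
      card (Cons 0 ` P) + card ((\<lambda>xs. 1 # g 1 # xs) ` Q)"
    using assms(2,3) by (intro card_Un_disjoint) auto
  finally show ?thesis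
    by (simp add: card_image inj_on_def)
qed

section \<open>Maximal runs and their parity, recursively along the list\<close>

lemma maximal_run_0_iff:
  "maximal_run a xs 0 j \<longleftrightarrow> 0 < j \<and> j = length (takeWhile (\<lambda>x. x = a) xs)"
proof (induction xs arbitrary: j)
  case Nil
  then show ?case
    by (auto simp: maximal_run_def)
next
  case (Cons x xs)
  show ?case
  proof (cases j)
    case (Suc k)
    have "(\<forall>l\<in>{0..<Suc k}. (x # xs) ! l = a) \<longleftrightarrow> x = a \<and> (\<forall>l\<in>{0..<k}. xs ! l = a)"
      unfolding atLeast0_lessThan_Suc_eq_insert_0
      by (simp del: image_Suc_atLeastLessThan image_Suc_lessThan add: atLeast0LessThan)
    \<comment> \<open>Runs are nonempty, so \<open>k = 0\<close> needs its own clause: the head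
      alone is then the whole run.\<close>
    then have "maximal_run a (x # xs) 0 (Suc k) \<longleftrightarrow>
        x = a \<and> (if k = 0 then xs = [] \<or> hd xs \<noteq> a else maximal_run a xs 0 k)"
      by (cases xs; cases k) (auto simp: maximal_run_def)
    then show ?thesis
      using Suc Cons.IH[of k] by (cases xs) auto
  qed (simp add: maximal_run_def)
qed

text \<open>Left maximality at \<open>Suc i\<close> inspects position \<open>i\<close>, which is
  inside \<open>xs\<close> unless \<open>i = 0\<close>; in that case it is the new head, whence the
  extra condition.\<close>

lemma maximal_run_Cons_Suc:
  "maximal_run a (x # xs) (Suc i) j \<longleftrightarrow>
     (\<exists>k. j = Suc k \<and> maximal_run a xs i k \<and> (i = 0 \<longrightarrow> x \<noteq> a))"
proof (cases j)
  case (Suc k)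
  have "(\<forall>l\<in>{Suc i..<Suc k}. (x # xs) ! l = a) \<longleftrightarrow> (\<forall>l\<in>{i..<k}. xs ! l = a)"
    unfolding image_Suc_atLeastLessThan[symmetric]
    by (simp del: image_Suc_atLeastLessThan)
  with Suc show ?thesis
    by (cases i) (auto simp: maximal_run_def)
qed (simp add: maximal_run_def)

definition even_runs :: "'a \<Rightarrow> 'a list \<Rightarrow> bool" where
  "even_runs a xs \<longleftrightarrow> (\<forall>i j. maximal_run a xs i j \<longrightarrow> even (j - i))"

text \<open>Leaves out a run at the very start, the only one whose length changes when
  \<open>a\<close> is prepended; this makes the condition amenable to recursion.\<close>

definition even_inner_runs :: "'a \<Rightarrow> 'a list \<Rightarrow> bool" where
  "even_inner_runs a xs \<longleftrightarrow> (\<forall>i j. maximal_run a xs (Suc i) j \<longrightarrow> even (j - Suc i))"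

text \<open>If no run starts at position 0, the prefix has length 0, which is even, so no case
  distinction arises.\<close>

lemma even_runs_iff:
  "even_runs a xs \<longleftrightarrow> even (length (takeWhile (\<lambda>x. x = a) xs)) \<and> even_inner_runs a xs"
proof -
  have "even_runs a xs \<longleftrightarrow> (\<forall>j. maximal_run a xs 0 j \<longrightarrow> even j) \<and> even_inner_runs a xs"
    unfolding even_runs_def even_inner_runs_def by (metis diff_zero not0_implies_Suc)
  then show ?thesis
    by (auto simp: maximal_run_0_iff intro: Nat.gr0I)
qed

text \<open>Prepending \<open>a\<close> absorbs an initial run of \<open>xs\<close> into one
  starting at the head; prepending another letter turns that initial run into an inner one.\<close>

lemma even_inner_runs_Cons:
  "even_inner_runs a (x # xs) \<longleftrightarrow> (if x = a then even_inner_runs a xs else even_runs a xs)"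
proof (cases "x = a")
  case True
  have "even_inner_runs a (x # xs) \<longleftrightarrow> (\<forall>i k. maximal_run a xs (Suc i) k \<longrightarrow> even (k - Suc i))"
    using True unfolding even_inner_runs_def maximal_run_Cons_Suc
    by (metis diff_Suc_Suc nat.distinct(1) not0_implies_Suc)
  with True show ?thesis
    by (simp add: even_inner_runs_def)
next
  case False
  have "even_inner_runs a (x # xs) \<longleftrightarrow> (\<forall>i k. maximal_run a xs i k \<longrightarrow> even (k - i))"
    using False unfolding even_inner_runs_def maximal_run_Cons_Suc by (metis diff_Suc_Suc)
  with False show ?thesis
    by (simp add: even_runs_def)
qed

lemma even_runs_Cons_neq: "x \<noteq> a \<Longrightarrow> even_runs a (x # xs) \<longleftrightarrow> even_runs a xs"
  by (simp add: even_runs_iff[of a "x # xs"] even_inner_runs_Cons)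

lemma even_runs_Cons_Cons_eq: "even_runs a (a # a # xs) \<longleftrightarrow> even_runs a xs"
  by (simp add: even_runs_iff even_inner_runs_Cons)

lemma even_runs_Cons_Cons_neq: "y \<noteq> a \<Longrightarrow> \<not> even_runs a (a # y # xs)"
  by (simp add: even_runs_iff)

lemma even_runs_Nil: "even_runs a []"
  by (simp add: even_runs_def maximal_run_def)

lemma not_even_runs_singleton: "\<not> even_runs a [a]"
  by (simp add: even_runs_iff)

section \<open>Counting words with even runs\<close>

lemma even_run_words_alt:
  "even_run_words m = {xs \<in> words {0, 1, 2} m. even_runs 1 xs \<and> even_runs 2 xs}"
  by (simp add: even_run_words_def even_runs_def)

lemma even_run_words_Suc_Suc:
  "even_run_words (Suc (Suc m)) = Cons 0 ` even_run_words (Suc m) \<union>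
     (\<lambda>xs. 1 # 1 # xs) ` even_run_words m \<union> (\<lambda>xs. 2 # 2 # xs) ` even_run_words m"
proof (intro subset_antisym subsetI)
  fix xs
  assume xs: "xs \<in> even_run_words (Suc (Suc m))"
  then have "xs \<in> words {0, 1, 2} (Suc (Suc m))"
    by (simp add: even_run_words_def)
  then obtain x y zs where x: "xs = x # y # zs" "x \<in> {0, 1, 2}" "zs \<in> words {0, 1, 2} m"
      "y # zs \<in> words {0, 1, 2} (Suc m)"
    by (rule words_two_cases)
  \<comment> \<open>Otherwise the first letter would be a run of length one.\<close>
  have "x = y" if "x = 1 \<or> x = 2"
    using that xs x(1) even_runs_Cons_Cons_neq[of y x zs] by (auto simp: even_run_words_alt)
  with x xs show "xs \<in> Cons 0 ` even_run_words (Suc m) \<union>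
     (\<lambda>xs. 1 # 1 # xs) ` even_run_words m \<union> (\<lambda>xs. 2 # 2 # xs) ` even_run_words m"
    by (auto simp: even_run_words_alt even_runs_Cons_neq even_runs_Cons_Cons_eq)
qed (auto simp: even_run_words_alt words_def even_runs_Cons_neq even_runs_Cons_Cons_eq
    simp del: One_nat_def)

lemma finite_even_run_words: "finite (even_run_words m)"
  by (simp add: even_run_words_def finite_words)

lemma card_even_run_words: "card (even_run_words m) = jacobsthal (m + 1)"
proof (rule jacobsthal_recurrence_unique)
  have "even_run_words 0 = {[]}"
    by (auto simp: even_run_words_alt words_0 even_runs_Nil)
  then show "card (even_run_words 0) = jacobsthal 1"
    by simp
  have "even_run_words (Suc 0) = {[0]}"
    by (auto simp: even_run_words_alt words_def length_Suc_conv even_runs_Nil even_runs_Cons_neq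
        not_even_runs_singleton not_even_runs_singleton[of "Suc 0", simplified])
  then show "card (even_run_words (Suc 0)) = jacobsthal (Suc 1)"
    by simp
  show "card (even_run_words (Suc (Suc k))) = card (even_run_words (Suc k)) + 2 * card (even_run_words k)" for k
    by (rule jacobsthal_step_card[where g = "\<lambda>a. a"])
      (simp_all only: even_run_words_Suc_Suc finite_even_run_words)
qed

section \<open>Counting words without adjacent nonzero letters\<close>

lemma no_adjacent_nonzero_Cons_Cons:
  fixes xs :: "nat list"
  shows "(\<forall>i. Suc i < length (x # y # xs) \<longrightarrow> \<not> ((x # y # xs) ! i \<noteq> 0 \<and> (x # y # xs) ! Suc i \<noteq> 0)) \<longleftrightarrow>
    (x = 0 \<or> y = 0) \<and>
    (\<forall>i. Suc i < length (y # xs) \<longrightarrow> \<not> ((y # xs) ! i \<noteq> 0 \<and> (y # xs) ! Suc i \<noteq> 0))"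
proof -
  have split: "(\<forall>i. P i) \<longleftrightarrow> P 0 \<and> (\<forall>i. P (Suc i))" for P :: "nat \<Rightarrow> bool"
    by (metis not0_implies_Suc)
  show ?thesis
    by (subst split) simp
qed

lemma no_adjacent_nonzero_words_Cons_Cons:
  "x # y # xs \<in> no_adjacent_nonzero_words (Suc m) \<longleftrightarrow>
     x \<in> {0, 1, 2} \<and> (x = 0 \<or> y = 0) \<and> y # xs \<in> no_adjacent_nonzero_words m"
  unfolding no_adjacent_nonzero_words_def mem_Collect_eq no_adjacent_nonzero_Cons_Cons
  by (auto simp: words_def)

text \<open>A leading 0 conflicts with no neighbor. The empty tail is separate because the preceding
  rule inspects two letters.\<close>

lemma no_adjacent_nonzero_words_0_Cons:
  "0 # xs \<in> no_adjacent_nonzero_words (Suc m) \<longleftrightarrow> xs \<in> no_adjacent_nonzero_words m"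
proof (cases xs)
  case Nil
  then show ?thesis
    by (simp add: no_adjacent_nonzero_words_def words_def)
qed (simp add: no_adjacent_nonzero_words_Cons_Cons)

lemma no_adjacent_nonzero_words_Suc_Suc:
  "no_adjacent_nonzero_words (Suc (Suc m)) = Cons 0 ` no_adjacent_nonzero_words (Suc m) \<union>
     (\<lambda>xs. 1 # 0 # xs) ` no_adjacent_nonzero_words m \<union>
     (\<lambda>xs. 2 # 0 # xs) ` no_adjacent_nonzero_words m"
proof (intro subset_antisym subsetI)
  fix xs
  assume xs: "xs \<in> no_adjacent_nonzero_words (Suc (Suc m))"
  then have "xs \<in> words {0, 1, 2} (Suc (Suc m))"
    by (simp add: no_adjacent_nonzero_words_def)
  then obtain x y zs where "xs = x # y # zs"
    by (rule words_two_cases)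
  with xs show "xs \<in> Cons 0 ` no_adjacent_nonzero_words (Suc m) \<union>
     (\<lambda>xs. 1 # 0 # xs) ` no_adjacent_nonzero_words m \<union>
     (\<lambda>xs. 2 # 0 # xs) ` no_adjacent_nonzero_words m"
    by (auto simp: no_adjacent_nonzero_words_Cons_Cons no_adjacent_nonzero_words_0_Cons)
qed (auto simp: no_adjacent_nonzero_words_Cons_Cons no_adjacent_nonzero_words_0_Cons)

lemma finite_no_adjacent_nonzero_words: "finite (no_adjacent_nonzero_words m)"
  by (simp add: no_adjacent_nonzero_words_def finite_words)

lemma card_no_adjacent_nonzero_words: "card (no_adjacent_nonzero_words m) = jacobsthal (m + 2)"
proof (rule jacobsthal_recurrence_unique)
  have "no_adjacent_nonzero_words 0 = {[]}"
    by (auto simp: no_adjacent_nonzero_words_def words_0)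
  then show "card (no_adjacent_nonzero_words 0) = jacobsthal 2"
    by (simp add: numeral_2_eq_2)
  \<comment> \<open>A single letter is unrestricted, so the counts start 1, 3, which are the
    Jacobsthal numbers of index 2 and 3.\<close>
  have "no_adjacent_nonzero_words (Suc 0) = {[0], [1], [2]}"
    by (auto simp: no_adjacent_nonzero_words_def words_def length_Suc_conv)
  then show "card (no_adjacent_nonzero_words (Suc 0)) = jacobsthal (Suc 2)"
    by (simp add: numeral_2_eq_2)
  show "card (no_adjacent_nonzero_words (Suc (Suc k))) =
      card (no_adjacent_nonzero_words (Suc k)) + 2 * card (no_adjacent_nonzero_words k)" for k
    by (rule jacobsthal_step_card[where g = "\<lambda>_. 0"])
      (simp_all only: no_adjacent_nonzero_words_Suc_Suc finite_no_adjacent_nonzero_words)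
qed

section \<open>Bijections from equal cardinalities\<close>

theorem theorem3p3:
  fixes n :: nat
  assumes "0 < n"
  shows
    "(\<exists>f. bij_betw f (colored_compositions (\<lambda>k. fib (k - 1)) n) (compositions_last_odd (n - 1))) \<and>
     (\<exists>f. bij_betw f (colored_compositions (\<lambda>k. fib (k - 1)) n) (compositions_last_even n)) \<and>
     (2 < n \<longrightarrow>
       (\<exists>f. bij_betw f (colored_compositions (\<lambda>k. fib (k - 1)) n) (even_run_words (n - 2))) \<and>
       (\<exists>f. bij_betw f (colored_compositions (\<lambda>k. fib (k - 1)) n)
              (no_adjacent_nonzero_words (n - 3)))) \<and>
     finite (colored_compositions (\<lambda>k. fib (k - 1)) n) \<and>
     card (colored_compositions (\<lambda>k. fib (k - 1)) n) = jacobsthal (n - 1)"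
proof -
  obtain m where n: "n = Suc m"
    using assms gr0_implies_Suc by blast
  let ?C = "colored_compositions (\<lambda>k. fib (k - 1)) n"
  have card: "card ?C = jacobsthal (n - 1)"
    by (simp only: n card_fib_colored_compositions diff_Suc_1)
  \<comment> \<open>No explicit correspondence is built: finite sets of equal size are in
    bijection.\<close>
  have bij: "\<exists>f. bij_betw f ?C X" if "finite X" "card X = jacobsthal (n - 1)" for X :: "nat list set"
    using that card by (simp add: finite_same_card_bij finite_colored_compositions)
  have "\<exists>f. bij_betw f ?C (compositions_last_odd (n - 1))"
    by (intro bij finite_compositions_last_odd card_compositions_last_odd)
  moreover have "\<exists>f. bij_betw f ?C (compositions_last_even n)"
    by (intro bij finite_compositions_last_even)
      (simp add: n card_compositions_last_even_Suc card_compositions_last_odd)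
  moreover have "\<exists>f. bij_betw f ?C (even_run_words (n - 2))" if "2 < n"
  proof (intro bij finite_even_run_words)
    have "n - 2 + 1 = n - 1"
      using that by simp
    then show "card (even_run_words (n - 2)) = jacobsthal (n - 1)"
      by (simp only: card_even_run_words)
  qed
  moreover have "\<exists>f. bij_betw f ?C (no_adjacent_nonzero_words (n - 3))" if "2 < n"
  proof (intro bij finite_no_adjacent_nonzero_words)
    \<comment> \<open>Natural subtraction truncates: for \<open>n = 2\<close> the left side would be
      2 and the right side 1.\<close>
    have "n - 3 + 2 = n - 1"
      using that by simp
    then show "card (no_adjacent_nonzero_words (n - 3)) = jacobsthal (n - 1)"
      by (simp only: card_no_adjacent_nonzero_words)
  qed
  ultimately show ?thesis
    using card finite_colored_compositions by blast
qed

end
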